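(* Let $n\in\mathbb N$ with $n\ge 16$. Put $k:=\lfloor \log_2 n\rfloor-4$, $m:=\lfloor n2^{-k}\rfloor+1$ and $\tilde n:=m2^k$. Then $$\tilde n\le \frac{17}{16}\,n .$$ Moreover, if $n$ is a power of two, then $\tilde n=\frac{17}{16}n$.
   Context: $\lfloor x\rfloor$ denotes the largest integer not greater than $x$. The number $\tilde n$ is the order to which an $(n\times n)$ matrix is padded with zero rows and columns so that Strassen's recursive matrix multiplication algorithm (which applies to matrices of order $m2^k$) can be used, with Strassen's choice of $m$ and $k$. *)

theory Defs
  imports Complex_Main
begin

end

theory Submission
  imports Defs
begin

text \<open>
  Rounding the quotient \<open>n / 2\<^sup>k\<close> up to \<open>m\<close> costs at most one unit, hence padding adds at most
  \<open>2\<^sup>k\<close> to \<open>n\<close>. The choice of \<open>k\<close> makes \<open>16 \<cdot> 2\<^sup>k\<close> the largest power of two not exceeding \<open>n\<close>,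
  so that \<open>2\<^sup>k\<close> is at most \<open>n / 16\<close>. When \<open>n\<close> is itself a power of two, both estimates are
  attained: the quotient is the integer \<open>16\<close>, which is rounded to \<open>m = 17\<close>.
\<close>

theorem theorem2p1:
  fixes n :: nat and k m :: int and n_tilde :: real
  assumes "n \<ge> 16"
    and "k = \<lfloor>log 2 (real n)\<rfloor> - 4"
    and "m = \<lfloor>real n * 2 powi (- k)\<rfloor> + 1"
    and "n_tilde = real_of_int m * 2 powi k"
  shows "n_tilde \<le> 17 / 16 * real n \<and>
         ((\<exists>j::nat. n = 2 ^ j) \<longrightarrow> n_tilde = 17 / 16 * real n)"
proof (intro conjI impI)
  define p :: real where "p = 2 powi k"
  have p_pos: "p > 0"
    by (simp add: p_def)
  have m_eq: "m = \<lfloor>real n / p\<rfloor> + 1"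
    using assms(3) by (simp add: p_def power_int_minus field_simps)
  have n_tilde_eq: "n_tilde = real_of_int m * p"
    using assms(4) by (simp add: p_def)
  have sixteen_p: "16 * p = 2 powi \<lfloor>log 2 (real n)\<rfloor>"
    by (simp add: p_def assms(2) power_int_diff)
  have "2 powi \<lfloor>log 2 (real n)\<rfloor> = (2::real) powr real_of_int \<lfloor>log 2 (real n)\<rfloor>"
    by (simp add: powr_real_of_int')
  also have "\<dots> \<le> 2 powr log 2 (real n)"
    by (intro powr_mono) auto
  also have "\<dots> = real n"
    using assms(1) by simp
  finally have p_le: "16 * p \<le> real n"
    by (simp add: sixteen_p)
  have "n_tilde \<le> (real n / p + 1) * p"
    unfolding n_tilde_eq m_eq using p_pos by (intro mult_right_mono) auto
  also have "\<dots> = real n + p"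
    using p_pos by (simp add: field_simps)
  finally show "n_tilde \<le> 17 / 16 * real n"
    using p_le by simp
  assume "\<exists>j::nat. n = 2 ^ j"
  then obtain j :: nat where "n = 2 ^ j" ..
  then have "real n = 16 * p"
    by (simp add: sixteen_p log_nat_power)
  then show "n_tilde = 17 / 16 * real n"
    using p_pos by (simp add: n_tilde_eq m_eq)
qed

end
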